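(* The non-well-founded nested sequent calculus $\mathcal{S}\mathsf{GL}^{\infty}_{\omega_1}$ is sound for transitive conversely well-founded Kripke models: for every nested sequent $\Gamma$ derivable in $\mathcal{S}\mathsf{GL}^{\infty}_{\omega_1}$, every transitive conversely well-founded Kripke model $\mathcal{K}$ supporting $\Gamma$ and every world $w$ of $\mathcal{K}$, we have $\mathcal{K},w\models\Gamma$.
   Context: **Language.** Fix a set of atoms. Formulas of the infinitary modal language $\mathcal{L}^{\Box}_{\omega_1}$ are generated inductively by $A::=p\mid\overline{p}\mid\bigwedge X\mid\bigvee X\mid\Box A\mid\lozenge A$, with $p$ an atom and $X$ a countable (possibly finite or empty) set of formulas. Negation is defined by $\neg p=\overline p$, $\neg\overline p=p$, $\neg\bigwedge X=\bigvee\{\neg A:A\in X\}$, $\neg\bigvee X=\bigwedge\{\neg A:A\in X\}$, $\neg\Box A=\lozenge\neg A$, $\neg\lozenge A=\Box\neg A$; $\top=\bigwedge\emptyset$, $\bot=\bigvee\emptyset$. **Nested sequents.** By simultaneous induction: a nested sequent is a finite multiset of nested formulas; a nested formula is either an $\mathcal{L}^{\Box}_{\omega_1}$-formula or $[\Gamma]$ with $\Gamma$ a non-empty nested sequent. Comma denotes multiset union, and $A$ also denotes the sequent $\{A\}$. The syntax-tree of $\Gamma$ has a root whose children correspond to the members of $\Gamma$ (with multiplicity): a formula gives a leaf labelled by it, and $[\Theta]$ gives a bracket node whose children correspond in the same way to the members of $\Theta$, and so on. An occurrence in $\Gamma$ is the root or a bracket node of this tree; it is an occurrence of the nested sequent formed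 by its children. An occurrence is a sub-occurrence of another if it is equal to it or a descendant of it in the tree. $\Gamma\{\Delta\}$ denotes a nested sequent with a designated occurrence of $\Delta$ (so $\Delta$ is the whole sequent or the whole content of a bracket), and $\Gamma\{\Delta'\}$ is the result of replacing it by $\Delta'$. **Rules.** ($\neg$) axiom $\Gamma\{\Delta,p,\overline p\}$, $p$ an atom; ($\wedge$) from $\Gamma\{\Delta,\bigwedge X,A\}$ for all $A\in X$ infer $\Gamma\{\Delta,\bigwedge X\}$ (for $X=\emptyset$ this is the axiom $\Gamma\{\Delta,\top\}$, called the $\top$-axiom); ($\vee$) from $\Gamma\{\Delta,\bigvee X,A\}$, for one $A\in X$, infer $\Gamma\{\Delta,\bigvee X\}$; ($\lozenge$) from $\Gamma\{\Delta,[\Theta,A,\lozenge A],\lozenge A\}$ infer $\Gamma\{\Delta,[\Theta],\lozenge A\}$; ($\Box$) from $\Gamma\{\Delta,[A],\Box A\}$ infer $\Gamma\{\Delta,\Box A\}$. A partial proof-tree is a rooted tree (possibly infinitely branching and with infinite branches; each node has finitely many predecessors) labelled by nested sequents, where each non-leaf label follows from the labels of its children (the nodes immediately above it) by one of the rules. Going upwards, rules only add nodes to syntax-trees, so every occurrence in a sequent is also regarded as an occurrence in all sequents above it. **The calculus $\mathcal{S}\mathsf{GL}^{\infty}_{\omega_1}$.** Let an instance $D_1$ of the $\Box$-rule, inferring $\Gamma'\{\Theta',\Box A'\}$ from $\Gamma'\{\Theta',[A'],\Box A'\}$, appear above an instance $D_0$, inferring $\Gamma\{\Theta,\Box A\}$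 from $\Gamma\{\Theta,[A],\Box A\}$. $D_1$ is nested in $D_0$ if the designated occurrence of $\Theta',\Box A'$ in the conclusion of $D_1$ is a sub-occurrence of the bracket $[A]$ created by $D_0$. A proof is a partial proof-tree all of whose leaves are instances of the $\neg$-axiom or $\top$-axiom and such that every infinite branch includes infinitely many instances of $\Box$-rules, each of them nested in the previous one. $\Gamma$ is derivable if it labels the root of a proof. **Kripke models.** A Kripke model is $\mathcal{K}=(W,\sqsubset,\mathrel{E},S)$ with $\sqsubset$ a binary relation on $W$, $S$ a set of atoms, and $E\subseteq W\times S$. It supports a formula or sequent if all atoms occurring in it are in $S$. Satisfaction: $w\models p$ iff $w\mathrel{E}p$; $w\models\overline p$ iff $w\not\models p$; $w\models\bigwedge X$ iff $w\models A$ for all $A\in X$; $w\models\bigvee X$ iff $w\models A$ for some $A\in X$; $w\models\Box A$ iff $u\models A$ for all $u\sqsupset w$; $w\models\lozenge A$ iff $u\models A$ for some $u\sqsupset w$; for sequents, $w\models\Gamma$ iff $w\models A$ for some $A\in\Gamma$, and $w\models[\Gamma]$ iff $u\models\Gamma$ for all $u\sqsupset w$. $\mathcal{K}$ is transitive (conversely well-founded) iff $(W,\sqsubset)$ is. *)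

theory Defs
  imports "HOL-Library.Multiset" "HOL-Library.Countable_Set_Type" "HOL-Library.Sublist"
begin

text \<open>The type \<open>'p\<close> is the set of atoms. The generated set function \<open>fm_atoms\<close> collects the atoms
  of both \<open>Pos p\<close> and \<open>Neg p\<close>; here \<open>Neg p\<close> is the literal written as an overlined \<open>p\<close>.\<close>

datatype (fm_atoms: 'p) fm =
    Pos 'p
  | Neg 'p
  | Conj "'p fm cset"
  | Disj "'p fm cset"
  | Box "'p fm"
  | Dia "'p fm"

abbreviation Top :: "'p fm" where "Top \<equiv> Conj cempty"

datatype (nf_atoms: 'p) nf =
    Fm "'p fm"
  | Br "'p nf multiset"

type_synonym 'p sequent = "'p nf multiset"

text \<open>The datatype admits the empty bracket \<open>Br {#}\<close>, which is not a nested formula.\<close>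

inductive nested_formula :: "'p nf \<Rightarrow> bool" where
  "nested_formula (Fm A)"
| "\<Gamma> \<noteq> {#} \<Longrightarrow> \<forall>F\<in>#\<Gamma>. nested_formula F \<Longrightarrow> nested_formula (Br \<Gamma>)"

definition nested_sequent :: "'p sequent \<Rightarrow> bool" where
  "nested_sequent \<Gamma> \<longleftrightarrow> (\<forall>F\<in>#\<Gamma>. nested_formula F)"

definition seq_atoms :: "'p sequent \<Rightarrow> 'p set" where
  "seq_atoms \<Gamma> = (\<Union>F\<in>set_mset \<Gamma>. nf_atoms F)"


section \<open>Syntax-trees and occurrences\<close>

text \<open>Occurrences have an identity that a multiset does not record (two equal brackets in a sequent
  are different occurrences, and each persists in the sequents above). A sequent is therefore
  handled through its syntax-tree, with the children of every node listed in some order; the tree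
  is given by the list of children of its root. All rules retain the formulas and brackets of the
  conclusion, and below they add new nodes at the end of a list of children. Hence an address
  (the list of child indices leading to a bracket node) denotes the same occurrence in a sequent
  and in all sequents above it, and one occurrence is a sub-occurrence of another iff its address
  extends the address of the other.\<close>

datatype 'p stnode =
    Lf "'p fm"
  | Bracket "'p stnode list"

type_synonym 'p stree = "'p stnode list"
type_synonym occ = "nat list"

primrec nf_of :: "'p stnode \<Rightarrow> 'p nf" where
  "nf_of (Lf A) = Fm A"
| "nf_of (Bracket \<Gamma>) = Br (mset (map nf_of \<Gamma>))"

definition sequent_of :: "'p stree \<Rightarrow> 'p sequent" where
  "sequent_of \<Gamma> = mset (map nf_of \<Gamma>)"

text \<open>\<open>content \<Gamma> \<pi> = Some \<Delta>\<close>: the address \<open>\<pi>\<close> is an occurrence of \<open>\<Delta>\<close> in \<open>\<Gamma>\<close>. In that case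
  \<open>replace \<Gamma> \<pi> \<Delta>'\<close> is the result of replacing this occurrence of \<open>\<Delta>\<close> by \<open>\<Delta>'\<close>.\<close>

fun content :: "'p stree \<Rightarrow> occ \<Rightarrow> 'p stree option" where
  "content \<Gamma> [] = Some \<Gamma>"
| "content \<Gamma> (i # \<pi>) =
     (if i < length \<Gamma> then (case \<Gamma> ! i of Lf A \<Rightarrow> None | Bracket \<Theta> \<Rightarrow> content \<Theta> \<pi>) else None)"

fun replace :: "'p stree \<Rightarrow> occ \<Rightarrow> 'p stree \<Rightarrow> 'p stree" where
  "replace \<Gamma> [] \<Delta>' = \<Delta>'"
| "replace \<Gamma> (i # \<pi>) \<Delta>' =
     \<Gamma>[i := (case \<Gamma> ! i of Lf A \<Rightarrow> Lf A | Bracket \<Theta> \<Rightarrow> Bracket (replace \<Theta> \<pi> \<Delta>'))]"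


section \<open>Rules\<close>

definition neg_axiom :: "'p stree \<Rightarrow> bool" where
  "neg_axiom \<Gamma> \<longleftrightarrow>
     (\<exists>\<pi> \<Delta> p. content \<Gamma> \<pi> = Some \<Delta> \<and> Lf (Pos p) \<in> set \<Delta> \<and> Lf (Neg p) \<in> set \<Delta>)"

definition top_axiom :: "'p stree \<Rightarrow> bool" where
  "top_axiom \<Gamma> \<longleftrightarrow> (\<exists>\<pi> \<Delta>. content \<Gamma> \<pi> = Some \<Delta> \<and> Lf Top \<in> set \<Delta>)"

text \<open>The parameters of a rule instance: the occurrence it acts on, the principal formula, the
  chosen disjunct for \<open>OrR\<close>, and for \<open>DiaR\<close> the index of the bracket that receives the formulas.\<close>

datatype 'p inst =
    AndR occ "'p fm cset"
  | OrR occ "'p fm cset" "'p fm"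
  | DiaR occ nat "'p fm"
  | BoxR occ "'p fm"

text \<open>\<open>infers r \<Gamma> P\<close>: the instance \<open>r\<close> has conclusion \<open>\<Gamma>\<close> and set of premises \<open>P\<close>. The case
  \<open>X = cempty\<close> of \<open>AndR\<close> is \<open>top_axiom\<close> and is treated as a leaf.\<close>

inductive infers :: "'p inst \<Rightarrow> 'p stree \<Rightarrow> 'p stree set \<Rightarrow> bool" where
  And: "content \<Gamma> \<pi> = Some \<Delta> \<Longrightarrow> Lf (Conj X) \<in> set \<Delta> \<Longrightarrow> X \<noteq> cempty \<Longrightarrow>
    infers (AndR \<pi> X) \<Gamma> {replace \<Gamma> \<pi> (\<Delta> @ [Lf A]) | A. cin A X}"
| Or: "content \<Gamma> \<pi> = Some \<Delta> \<Longrightarrow> Lf (Disj X) \<in> set \<Delta> \<Longrightarrow> cin A X \<Longrightarrow>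
    infers (OrR \<pi> X A) \<Gamma> {replace \<Gamma> \<pi> (\<Delta> @ [Lf A])}"
| Dia: "content \<Gamma> \<pi> = Some \<Delta> \<Longrightarrow> Lf (Dia A) \<in> set \<Delta> \<Longrightarrow>
    i < length \<Delta> \<Longrightarrow> \<Delta> ! i = Bracket \<Theta> \<Longrightarrow>
    infers (DiaR \<pi> i A) \<Gamma> {replace \<Gamma> \<pi> (\<Delta>[i := Bracket (\<Theta> @ [Lf A, Lf (Dia A)])])}"
| Box: "content \<Gamma> \<pi> = Some \<Delta> \<Longrightarrow> Lf (Box A) \<in> set \<Delta> \<Longrightarrow>
    infers (BoxR \<pi> A) \<Gamma> {replace \<Gamma> \<pi> (\<Delta> @ [Bracket [Lf A]])}"


section \<open>Non-well-founded proofs\<close>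

codatatype 'p ptree =
    Leaf (concl: "'p stree")
  | Step (concl: "'p stree") "'p inst" "'p ptree cset"

fun children :: "'p ptree \<Rightarrow> 'p ptree set" where
  "children (Leaf \<Gamma>) = {}"
| "children (Step \<Gamma> r T) = rcset T"

definition subtree :: "'p ptree \<Rightarrow> 'p ptree \<Rightarrow> bool" where
  "subtree u t \<longleftrightarrow> (\<lambda>t u. u \<in> children t)\<^sup>*\<^sup>* t u"

text \<open>A node is identified with the subtree above it. The bijection says that every premise is the
  label of exactly one child, so different siblings carry different labels.\<close>

definition partial_proof_tree :: "'p ptree \<Rightarrow> bool" where
  "partial_proof_tree t \<longleftrightarrow> (\<forall>u. subtree u t \<longrightarrow>
     nested_sequent (sequent_of (concl u)) \<and>
     (\<forall>\<Gamma> r T. u = Step \<Gamma> r T \<longrightarrow> (\<exists>P. infers r \<Gamma> P \<and> bij_betw concl (rcset T) P)))"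

definition infinite_branch :: "'p ptree \<Rightarrow> (nat \<Rightarrow> 'p ptree) \<Rightarrow> bool" where
  "infinite_branch t b \<longleftrightarrow> b 0 = t \<and> (\<forall>n. b (Suc n) \<in> children (b n))"

text \<open>The bracket created by a box instance at the occurrence \<open>\<pi>\<^sub>0\<close> of \<open>\<Delta>\<^sub>0\<close> has the address
  \<open>\<pi>\<^sub>0 @ [length \<Delta>\<^sub>0]\<close>. The relation is applied to nodes of one branch, the first argument above
  the second.\<close>

definition nested_in :: "'p ptree \<Rightarrow> 'p ptree \<Rightarrow> bool" where
  "nested_in D\<^sub>1 D\<^sub>0 \<longleftrightarrow>
     (\<exists>\<Gamma>\<^sub>0 \<pi>\<^sub>0 A\<^sub>0 T\<^sub>0 \<Delta>\<^sub>0 \<Gamma>\<^sub>1 \<pi>\<^sub>1 A\<^sub>1 T\<^sub>1.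
        D\<^sub>0 = Step \<Gamma>\<^sub>0 (BoxR \<pi>\<^sub>0 A\<^sub>0) T\<^sub>0 \<and> D\<^sub>1 = Step \<Gamma>\<^sub>1 (BoxR \<pi>\<^sub>1 A\<^sub>1) T\<^sub>1 \<and>
        content \<Gamma>\<^sub>0 \<pi>\<^sub>0 = Some \<Delta>\<^sub>0 \<and> prefix (\<pi>\<^sub>0 @ [length \<Delta>\<^sub>0]) \<pi>\<^sub>1)"

definition is_proof :: "'p ptree \<Rightarrow> bool" where
  "is_proof t \<longleftrightarrow> partial_proof_tree t \<and>
     (\<forall>\<Gamma>. subtree (Leaf \<Gamma>) t \<longrightarrow> neg_axiom \<Gamma> \<or> top_axiom \<Gamma>) \<and>
     (\<forall>b. infinite_branch t b \<longrightarrow>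
        (\<exists>g :: nat \<Rightarrow> nat. strict_mono g \<and> (\<forall>k. nested_in (b (g (Suc k))) (b (g k)))))"

definition derivable :: "'p sequent \<Rightarrow> bool" where
  "derivable \<Gamma> \<longleftrightarrow> (\<exists>t. is_proof t \<and> sequent_of (concl t) = \<Gamma>)"


section \<open>Kripke models\<close>

record ('w, 'p) kripke =
  worlds :: "'w set"
  acc :: "('w \<times> 'w) set"
  atoms :: "'p set"
  val :: "('w \<times> 'p) set"

definition kripke_model :: "('w, 'p) kripke \<Rightarrow> bool" where
  "kripke_model K \<longleftrightarrow> acc K \<subseteq> worlds K \<times> worlds K \<and> val K \<subseteq> worlds K \<times> atoms K"

definition supports :: "('w, 'p) kripke \<Rightarrow> 'p sequent \<Rightarrow> bool" where
  "supports K \<Gamma> \<longleftrightarrow> seq_atoms \<Gamma> \<subseteq> atoms K"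

definition transitive_model :: "('w, 'p) kripke \<Rightarrow> bool" where
  "transitive_model K \<longleftrightarrow> trans (acc K)"

definition conversely_wf_model :: "('w, 'p) kripke \<Rightarrow> bool" where
  "conversely_wf_model K \<longleftrightarrow> wf ((acc K)\<inverse>)"

text \<open>Recursion through \<open>cset\<close> and \<open>multiset\<close> has to go through their map functions; the lemmas
  after the definitions state the clauses in the usual form.\<close>

primrec sat_fm :: "('w, 'p) kripke \<Rightarrow> 'p fm \<Rightarrow> 'w \<Rightarrow> bool" where
  "sat_fm K (Pos p) w \<longleftrightarrow> (w, p) \<in> val K"
| "sat_fm K (Neg p) w \<longleftrightarrow> (w, p) \<notin> val K"
| "sat_fm K (Conj X) w \<longleftrightarrow> (\<forall>b \<in> rcset (cimage (\<lambda>A. sat_fm K A w) X). b)"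
| "sat_fm K (Disj X) w \<longleftrightarrow> (\<exists>b \<in> rcset (cimage (\<lambda>A. sat_fm K A w) X). b)"
| "sat_fm K (Box A) w \<longleftrightarrow> (\<forall>u. (w, u) \<in> acc K \<longrightarrow> sat_fm K A u)"
| "sat_fm K (Dia A) w \<longleftrightarrow> (\<exists>u. (w, u) \<in> acc K \<and> sat_fm K A u)"

primrec sat_nf :: "('w, 'p) kripke \<Rightarrow> 'p nf \<Rightarrow> 'w \<Rightarrow> bool" where
  "sat_nf K (Fm A) w \<longleftrightarrow> sat_fm K A w"
| "sat_nf K (Br \<Gamma>) w \<longleftrightarrow> (\<forall>u. (w, u) \<in> acc K \<longrightarrow> (\<exists>b \<in># image_mset (\<lambda>F. sat_nf K F u) \<Gamma>. b))"

definition sat :: "('w, 'p) kripke \<Rightarrow> 'w \<Rightarrow> 'p sequent \<Rightarrow> bool" where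
  "sat K w \<Gamma> \<longleftrightarrow> (\<exists>F\<in>#\<Gamma>. sat_nf K F w)"

lemma sat_fm_Conj: "sat_fm K (Conj X) w \<longleftrightarrow> (\<forall>A. cin A X \<longrightarrow> sat_fm K A w)"
  by (auto simp: cimage.rep_eq cin.rep_eq)

lemma sat_fm_Disj: "sat_fm K (Disj X) w \<longleftrightarrow> (\<exists>A. cin A X \<and> sat_fm K A w)"
  by (auto simp: cimage.rep_eq cin.rep_eq)

lemma sat_nf_Br: "sat_nf K (Br \<Gamma>) w \<longleftrightarrow> (\<forall>u. (w, u) \<in> acc K \<longrightarrow> sat K u \<Gamma>)"
  by (auto simp: sat_def)

end

theory Submission imports Defs begin

text \<open>Suppose a world refutes the conclusion of a proof. Assign to every occurrence a world, with
  accessible worlds for nested brackets, such that all formulas of an occurrence fail at its world.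
  Going upwards, one premise of each rule is again refuted by such an assignment, which is only
  extended, by the bracket a \<open>\<box>\<close>-rule creates. This never ends at an axiom, so it follows an
  infinite branch, and the worlds assigned to the brackets created by successively nested
  \<open>\<box>\<close>-rules form, by transitivity, an infinite ascending
  chain, against converse well-foundedness.\<close>

section \<open>Occurrences, labelled addresses and refuting assignments\<close>

definition occs :: "'p stree \<Rightarrow> occ set" where
  "occs \<Gamma> = {\<pi>. content \<Gamma> \<pi> \<noteq> None}"

definition labels :: "'p stree \<Rightarrow> (occ \<times> 'p fm) set" where
  "labels \<Gamma> = {(\<pi>, A). \<exists>\<Delta>. content \<Gamma> \<pi> = Some \<Delta> \<and> Lf A \<in> set \<Delta>}"

text \<open>A failing bracket only asserts that some accessible world refutes its content;
  \<open>f\<close> records such choices for all occurrences at once. It is a total function, and its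
  values outside \<open>occs \<Gamma>\<close> are unconstrained, so it can be redefined at addresses
  that do not occur yet.\<close>

definition refutes :: "('w, 'p) kripke \<Rightarrow> (occ \<Rightarrow> 'w) \<Rightarrow> 'p stree \<Rightarrow> bool" where
  "refutes K f \<Gamma> \<longleftrightarrow>
     (\<forall>(\<pi>, A) \<in> labels \<Gamma>. \<not> sat_fm K A (f \<pi>)) \<and>
     (\<forall>\<pi> i. \<pi> @ [i] \<in> occs \<Gamma> \<longrightarrow> (f \<pi>, f (\<pi> @ [i])) \<in> acc K)"

lemma occs_Nil [simp]: "[] \<in> occs \<Gamma>"
  by (simp add: occs_def)

lemma occs_Cons:
  "i # \<pi> \<in> occs \<Gamma> \<longleftrightarrow> (\<exists>\<Theta>. i < length \<Gamma> \<and> \<Gamma> ! i = Bracket \<Theta> \<and> \<pi> \<in> occs \<Theta>)"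
  by (auto simp: occs_def split: stnode.splits)

lemma labels_Nil [simp]: "([], A) \<in> labels \<Gamma> \<longleftrightarrow> Lf A \<in> set \<Gamma>"
  by (simp add: labels_def)

lemma labels_Cons:
  "(i # \<pi>, A) \<in> labels \<Gamma> \<longleftrightarrow>
     (\<exists>\<Theta>. i < length \<Gamma> \<and> \<Gamma> ! i = Bracket \<Theta> \<and> (\<pi>, A) \<in> labels \<Theta>)"
  by (auto simp: labels_def split: stnode.splits)

lemma content_ConsE:
  assumes "content \<Gamma> (i # \<pi>) = Some \<Delta>"
  obtains \<Theta> where "i < length \<Gamma>" "\<Gamma> ! i = Bracket \<Theta>" "content \<Theta> \<pi> = Some \<Delta>"
  using assms by (auto split: if_splits stnode.splits)

section \<open>How replacement at an address changes occurrences and labels\<close>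

lemma content_append:
  "content \<Gamma> \<pi> = Some \<Delta> \<Longrightarrow> content \<Gamma> (\<pi> @ \<rho>) = content \<Delta> \<rho>"
  by (induction \<pi> arbitrary: \<Gamma>) (auto split: if_splits stnode.splits)

text \<open>With \<open>\<rho> = [i]\<close> this identifies overwriting the \<open>i\<close>-th
  bracket of \<Delta> with a replacement at the address \<open>\<pi> @ [i]\<close>, the form in
  which the diamond rule is treated.\<close>

lemma replace_append:
  "content \<Gamma> \<pi> = Some \<Delta> \<Longrightarrow> replace \<Gamma> (\<pi> @ \<rho>) E = replace \<Gamma> \<pi> (replace \<Delta> \<rho> E)"
  by (induction \<pi> arbitrary: \<Gamma>) (auto split: if_splits stnode.splits)

text \<open>The overwritten entry is a bracket before and after, so no leaf is gained or
  lost.\<close>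

lemma Lf_in_set_update_Bracket:
  assumes "i < length \<Gamma>" "\<Gamma> ! i = Bracket \<Theta>"
  shows "Lf A \<in> set (\<Gamma>[i := Bracket \<Theta>']) \<longleftrightarrow> Lf A \<in> set \<Gamma>"
proof -
  have "(\<exists>j<length \<Gamma>. \<Gamma>[i := Bracket \<Theta>'] ! j = Lf A) \<longleftrightarrow> (\<exists>j<length \<Gamma>. \<Gamma> ! j = Lf A)"
    using assms by (metis nth_list_update stnode.distinct(1))
  then show ?thesis by (simp add: in_set_conv_nth)
qed

lemma occs_update:
  assumes "i < length \<Gamma>"
  shows "j # \<rho> \<in> occs (\<Gamma>[i := Bracket \<Theta>]) \<longleftrightarrow>
    (if j = i then \<rho> \<in> occs \<Theta> else j # \<rho> \<in> occs \<Gamma>)"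
  using assms by (auto simp: occs_Cons labels_Cons)

lemma labels_update:
  assumes "i < length \<Gamma>"
  shows "(j # \<rho>, A) \<in> labels (\<Gamma>[i := Bracket \<Theta>]) \<longleftrightarrow>
    (if j = i then (\<rho>, A) \<in> labels \<Theta> else (j # \<rho>, A) \<in> labels \<Gamma>)"
  using assms by (auto simp: occs_Cons labels_Cons)

text \<open>Appending at the end shifts no index of an existing child, and a leaf has no address
  among the occurrences.\<close>

lemma occs_add_formula:
  "content \<Gamma> \<pi> = Some \<Delta> \<Longrightarrow> occs (replace \<Gamma> \<pi> (\<Delta> @ [Lf A])) = occs \<Gamma>"
proof (induction \<pi> arbitrary: \<Gamma>)
  case Nil
  have "\<rho> \<in> occs (\<Gamma> @ [Lf A]) \<longleftrightarrow> \<rho> \<in> occs \<Gamma>" for \<rho>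
    by (cases \<rho>) (auto simp: occs_Cons labels_Cons nth_append less_Suc_eq)
  with Nil show ?case by auto
next
  case (Cons i \<pi>)
  from Cons.prems obtain \<Theta> where *: "i < length \<Gamma>" "\<Gamma> ! i = Bracket \<Theta>" "content \<Theta> \<pi> = Some \<Delta>"
    by (rule content_ConsE)
  have "\<rho> \<in> occs (replace \<Gamma> (i # \<pi>) (\<Delta> @ [Lf A])) \<longleftrightarrow> \<rho> \<in> occs \<Gamma>" for \<rho>
    using * Cons.IH[OF *(3)]
    by (cases \<rho>) (auto simp: occs_update occs_Cons[of i _ \<Gamma>])
  then show ?case by (simp only: set_eq_iff simp_thms)
qed

lemma labels_add_formula:
  "content \<Gamma> \<pi> = Some \<Delta> \<Longrightarrow>
    labels (replace \<Gamma> \<pi> (\<Delta> @ [Lf A])) = insert (\<pi>, A) (labels \<Gamma>)"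
proof (induction \<pi> arbitrary: \<Gamma>)
  case Nil
  have "(\<rho>, B) \<in> labels (\<Gamma> @ [Lf A]) \<longleftrightarrow> (\<rho>, B) \<in> insert ([], A) (labels \<Gamma>)" for \<rho> B
    by (cases \<rho>) (auto simp: occs_Cons labels_Cons nth_append less_Suc_eq)
  with Nil show ?case by auto
next
  case (Cons i \<pi>)
  from Cons.prems obtain \<Theta> where *: "i < length \<Gamma>" "\<Gamma> ! i = Bracket \<Theta>" "content \<Theta> \<pi> = Some \<Delta>"
    by (rule content_ConsE)
  have "(\<rho>, B) \<in> labels (replace \<Gamma> (i # \<pi>) (\<Delta> @ [Lf A])) \<longleftrightarrow>
      (\<rho>, B) \<in> insert (i # \<pi>, A) (labels \<Gamma>)" for \<rho> B
    using * Cons.IH[OF *(3)]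
    by (cases \<rho>)
      (auto simp: labels_update Lf_in_set_update_Bracket labels_Cons[of i _ _ \<Gamma>])
  then show ?case by (simp only: set_eq_iff split_paired_All simp_thms)
qed

text \<open>The new bracket takes the next free index \<open>length \<Delta>\<close>; since it
  contains only a leaf, no further address arises below it.\<close>

lemma occs_add_bracket:
  "content \<Gamma> \<pi> = Some \<Delta> \<Longrightarrow>
    occs (replace \<Gamma> \<pi> (\<Delta> @ [Bracket [Lf A]])) = insert (\<pi> @ [length \<Delta>]) (occs \<Gamma>)"
proof (induction \<pi> arbitrary: \<Gamma>)
  case Nil
  have leaf: "\<rho> \<in> occs [Lf A] \<longleftrightarrow> \<rho> = []" for \<rho>
    by (cases \<rho>) (auto simp: occs_Cons labels_Cons)
  have "\<rho> \<in> occs (\<Gamma> @ [Bracket [Lf A]]) \<longleftrightarrow> \<rho> \<in> insert [length \<Gamma>] (occs \<Gamma>)" for \<rho>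
    by (cases \<rho>) (auto simp: occs_Cons labels_Cons nth_append less_Suc_eq leaf)
  with Nil show ?case by auto
next
  case (Cons i \<pi>)
  from Cons.prems obtain \<Theta> where *: "i < length \<Gamma>" "\<Gamma> ! i = Bracket \<Theta>" "content \<Theta> \<pi> = Some \<Delta>"
    by (rule content_ConsE)
  have "\<rho> \<in> occs (replace \<Gamma> (i # \<pi>) (\<Delta> @ [Bracket [Lf A]])) \<longleftrightarrow>
      \<rho> \<in> insert ((i # \<pi>) @ [length \<Delta>]) (occs \<Gamma>)" for \<rho>
    using * Cons.IH[OF *(3)]
    by (cases \<rho>) (auto simp: occs_update occs_Cons[of i _ \<Gamma>])
  then show ?case by (simp only: set_eq_iff simp_thms)
qed

lemma labels_add_bracket:
  "content \<Gamma> \<pi> = Some \<Delta> \<Longrightarrow>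
    labels (replace \<Gamma> \<pi> (\<Delta> @ [Bracket [Lf A]])) = insert (\<pi> @ [length \<Delta>], A) (labels \<Gamma>)"
proof (induction \<pi> arbitrary: \<Gamma>)
  case Nil
  have leaf: "(\<rho>, B) \<in> labels [Lf A] \<longleftrightarrow> \<rho> = [] \<and> B = A" for \<rho> B
    by (cases \<rho>) (auto simp: occs_Cons labels_Cons)
  have "(\<rho>, B) \<in> labels (\<Gamma> @ [Bracket [Lf A]]) \<longleftrightarrow>
      (\<rho>, B) \<in> insert ([length \<Gamma>], A) (labels \<Gamma>)" for \<rho> B
    by (cases \<rho>) (auto simp: occs_Cons labels_Cons nth_append less_Suc_eq leaf)
  with Nil show ?case by auto
next
  case (Cons i \<pi>)
  from Cons.prems obtain \<Theta> where *: "i < length \<Gamma>" "\<Gamma> ! i = Bracket \<Theta>" "content \<Theta> \<pi> = Some \<Delta>"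
    by (rule content_ConsE)
  have "(\<rho>, B) \<in> labels (replace \<Gamma> (i # \<pi>) (\<Delta> @ [Bracket [Lf A]])) \<longleftrightarrow>
      (\<rho>, B) \<in> insert ((i # \<pi>) @ [length \<Delta>], A) (labels \<Gamma>)" for \<rho> B
    using * Cons.IH[OF *(3)]
    by (cases \<rho>)
      (auto simp: labels_update Lf_in_set_update_Bracket labels_Cons[of i _ _ \<Gamma>])
  then show ?case by (simp only: set_eq_iff split_paired_All simp_thms)
qed

lemma content_replace:
  "content \<Gamma> \<pi> = Some \<Delta> \<Longrightarrow> content (replace \<Gamma> \<pi> \<Delta>') \<pi> = Some \<Delta>'"
  by (induction \<pi> arbitrary: \<Gamma>) (auto split: if_splits stnode.splits)

lemma replace_replace:
  "content \<Gamma> \<pi> = Some \<Delta> \<Longrightarrow> replace (replace \<Gamma> \<pi> E) \<pi> E' = replace \<Gamma> \<pi> E'"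
  by (induction \<pi> arbitrary: \<Gamma>) (auto split: if_splits stnode.splits)

text \<open>The children of \<Delta> have indices below \<open>length \<Delta>\<close>. Changing an
  assignment at the address of a bracket about to be created thus affects nothing already
  present.\<close>

lemma fresh_occ: "content \<Gamma> \<pi> = Some \<Delta> \<Longrightarrow> \<pi> @ (length \<Delta> # \<rho>) \<notin> occs \<Gamma>"
  by (simp add: occs_def content_append)

lemma occs_prefix: "\<pi> @ \<rho> \<in> occs \<Gamma> \<Longrightarrow> \<pi> \<in> occs \<Gamma>"
  by (induction \<pi> arbitrary: \<Gamma>) (auto simp: occs_Cons)

lemma labels_occs: "(\<pi>, A) \<in> labels \<Gamma> \<Longrightarrow> \<pi> \<in> occs \<Gamma>"
  by (auto simp: labels_def occs_def)

section \<open>Refuting assignments: existence, axioms and rules\<close>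

lemma refutes_add_formula:
  assumes "refutes K f \<Gamma>" "content \<Gamma> \<pi> = Some \<Delta>" "\<not> sat_fm K A (f \<pi>)"
  shows "refutes K f (replace \<Gamma> \<pi> (\<Delta> @ [Lf A]))"
  using assms by (auto simp: refutes_def occs_add_formula labels_add_formula)

lemma refutes_label:
  "refutes K f \<Gamma> \<Longrightarrow> content \<Gamma> \<pi> = Some \<Delta> \<Longrightarrow> Lf A \<in> set \<Delta> \<Longrightarrow> \<not> sat_fm K A (f \<pi>)"
  by (auto simp: refutes_def labels_def)

text \<open>By recursion on the syntax-tree: each bracket among the children fails at
  \<open>w\<close>, hence its content fails at some successor of \<open>w\<close>, from which an
  assignment for that subtree is built. These assignments are glued under the root.\<close>

lemma refutes_exists:
  assumes "\<not> sat K w (sequent_of \<Gamma>)"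
  shows "\<exists>f. f [] = w \<and> refutes K f \<Gamma>"
proof -
  \<comment> \<open>Structural induction runs over nodes, not over lists of nodes, so the sequent is
    presented as the content of a bracket \<open>n\<close>; the leaf case is vacuous.\<close>
  have "\<exists>f. f [] = w \<and> refutes K f \<Gamma>"
    if "n = Bracket \<Gamma>" "\<not> sat K w (sequent_of \<Gamma>)" for n :: "'b stnode" and \<Gamma> w
    using that
  proof (induction n arbitrary: \<Gamma> w)
    case (Lf A)
    then show ?case by simp
  next
    case (Bracket \<Gamma>' \<Gamma> w)
    have "\<exists>f. (w, f []) \<in> acc K \<and> refutes K f \<Theta>" if "i < length \<Gamma>" "\<Gamma> ! i = Bracket \<Theta>" for i \<Theta>
    proof -
      have "Bracket \<Theta> \<in> set \<Gamma>" using that by (metis nth_mem)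
      then have "\<not> sat_nf K (nf_of (Bracket \<Theta>)) w"
        using Bracket.prems by (auto simp: sat_def sequent_of_def simp del: nf_of.simps)
      then obtain u where "(w, u) \<in> acc K" "\<not> sat K u (sequent_of \<Theta>)"
        by (auto simp: sat_nf_Br sequent_of_def simp del: sat_nf.simps)
      with Bracket.IH[of "Bracket \<Theta>" \<Theta> u] Bracket.prems \<open>Bracket \<Theta> \<in> set \<Gamma>\<close>
      show ?thesis by auto
    qed
    \<comment> \<open>For an index that does not point to a bracket the condition is vacuous, so one
      function can be chosen for every \<open>i\<close>.\<close>
    then have "\<forall>i. \<exists>f. \<forall>\<Theta>. i < length \<Gamma> \<and> \<Gamma> ! i = Bracket \<Theta> \<longrightarrow> (w, f []) \<in> acc K \<and> refutes K f \<Theta>"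
      by (metis stnode.inject(2))
    then obtain g where g: "\<And>i \<Theta>. i < length \<Gamma> \<Longrightarrow> \<Gamma> ! i = Bracket \<Theta> \<Longrightarrow>
        (w, g i []) \<in> acc K \<and> refutes K (g i) \<Theta>"
      by metis
    \<comment> \<open>The first index of an address selects the subtree; the edge from the root to
      child \<open>i\<close> is the choice of \<open>g i []\<close> as a successor of
      \<open>w\<close>.\<close>
    define f where "f = (\<lambda>\<rho>. case \<rho> of [] \<Rightarrow> w | i # \<rho>' \<Rightarrow> g i \<rho>')"
    have "\<not> sat_fm K A (f \<rho>)" if "(\<rho>, A) \<in> labels \<Gamma>" for \<rho> A
    proof (cases \<rho>)
      case Nil
      with that have "Fm A \<in># sequent_of \<Gamma>" by (force simp: sequent_of_def)
      with Bracket.prems Nil show ?thesis by (auto simp: sat_def f_def)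
    next
      case (Cons i \<rho>')
      with that g show ?thesis by (fastforce simp: f_def refutes_def occs_Cons labels_Cons)
    qed
    moreover have "(f \<rho>, f (\<rho> @ [i])) \<in> acc K" if "\<rho> @ [i] \<in> occs \<Gamma>" for \<rho> i
      using that g by (cases \<rho>) (fastforce simp: f_def refutes_def occs_Cons labels_Cons)+
    ultimately show ?case by (auto simp: refutes_def f_def intro!: exI[of _ f])
  qed
  with assms show ?thesis by blast
qed

lemma axiom_not_refuted:
  assumes "neg_axiom \<Gamma> \<or> top_axiom \<Gamma>"
  shows "\<not> refutes K f \<Gamma>"
proof
  assume r: "refutes K f \<Gamma>"
  show False
    using assms
  proof
    assume "neg_axiom \<Gamma>"
    then obtain \<pi> \<Delta> p where "content \<Gamma> \<pi> = Some \<Delta>" "Lf (Pos p) \<in> set \<Delta>" "Lf (Neg p) \<in> set \<Delta>"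
      by (auto simp: neg_axiom_def)
    with refutes_label[OF r, of \<pi> \<Delta>] show False by (metis sat_fm.simps(1,2))
  next
    assume "top_axiom \<Gamma>"
    then obtain \<pi> \<Delta> where "content \<Gamma> \<pi> = Some \<Delta>" "Lf Top \<in> set \<Delta>"
      by (auto simp: top_axiom_def)
    with r have "\<not> sat_fm K Top (f \<pi>)" by (rule refutes_label)
    then show False by (simp add: sat_fm_Conj cin.rep_eq bot_cset.rep_eq del: sat_fm.simps)
  qed
qed

text \<open>Local soundness, read from the conclusion to a premise. Agreement on the old occurrences
  is what later makes the world of an occurrence constant along a branch. Transitivity enters in the
  diamond case, the change of \<open>f\<close> in the box case.\<close>

lemma infers_refutes:
  assumes "infers r \<Gamma> P" "refutes K f \<Gamma>" "trans (acc K)"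
  shows "\<exists>\<Gamma>'\<in>P. \<exists>f'. refutes K f' \<Gamma>' \<and> occs \<Gamma> \<subseteq> occs \<Gamma>' \<and> (\<forall>\<pi>\<in>occs \<Gamma>. f' \<pi> = f \<pi>)"
  using assms
proof cases
  case (And \<pi> \<Delta> X)
  then have "\<not> sat_fm K (Conj X) (f \<pi>)"
    using refutes_label[OF assms(2)] by blast
  then obtain A where "cin A X" "\<not> sat_fm K A (f \<pi>)"
    by (auto simp: sat_fm_Conj simp del: sat_fm.simps)
  then have "replace \<Gamma> \<pi> (\<Delta> @ [Lf A]) \<in> P" "refutes K f (replace \<Gamma> \<pi> (\<Delta> @ [Lf A]))"
    "occs (replace \<Gamma> \<pi> (\<Delta> @ [Lf A])) = occs \<Gamma>"
    using And assms(2) by (auto intro: refutes_add_formula simp: occs_add_formula)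
  then show ?thesis by blast
next
  case (Or \<pi> \<Delta> X A)
  then have "\<not> sat_fm K (Disj X) (f \<pi>)"
    using refutes_label[OF assms(2)] by blast
  with Or have "\<not> sat_fm K A (f \<pi>)"
    by (auto simp: sat_fm_Disj simp del: sat_fm.simps)
  with Or assms(2) show ?thesis
    using refutes_add_formula[of K f \<Gamma> \<pi> \<Delta> A] by (auto simp: occs_add_formula)
next
  case (Dia \<pi> \<Delta> A i \<Theta>)
  let ?\<pi> = "\<pi> @ [i]" and ?\<Gamma>' = "replace \<Gamma> \<pi> (\<Delta>[i := Bracket (\<Theta> @ [Lf A, Lf (Dia A)])])"
  let ?\<Gamma>\<^sub>1 = "replace \<Gamma> ?\<pi> (\<Theta> @ [Lf A])"
  have c: "content \<Gamma> ?\<pi> = Some \<Theta>"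
    using Dia by (simp add: content_append)
  have c1: "content ?\<Gamma>\<^sub>1 ?\<pi> = Some (\<Theta> @ [Lf A])"
    using content_replace[OF c] .
  \<comment> \<open>The rule adds two formulas to the bracket; adding them one after the other
    allows two uses of \<open>refutes_add_formula\<close>.\<close>
  have eq: "?\<Gamma>' = replace ?\<Gamma>\<^sub>1 ?\<pi> ((\<Theta> @ [Lf A]) @ [Lf (Dia A)])"
    using Dia by (simp only: replace_replace[OF c]) (simp add: replace_append)
  have nd: "\<not> sat_fm K (Dia A) (f \<pi>)"
    using refutes_label[OF assms(2)] Dia by blast
  have "?\<pi> \<in> occs \<Gamma>" using c by (simp add: occs_def)
  then have "(f \<pi>, f ?\<pi>) \<in> acc K"
    using assms(2) by (simp add: refutes_def)
  with nd assms(3) have "\<not> sat_fm K A (f ?\<pi>)" "\<not> sat_fm K (Dia A) (f ?\<pi>)"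
    by (auto dest: transD)
  then have "refutes K f ?\<Gamma>'"
    unfolding eq using assms(2) c c1 by (intro refutes_add_formula)
  moreover have "occs ?\<Gamma>' = occs \<Gamma>"
    unfolding eq occs_add_formula[OF c1] occs_add_formula[OF c] ..
  ultimately show ?thesis using Dia by auto
next
  case (Box \<pi> \<Delta> A)
  let ?\<sigma> = "\<pi> @ [length \<Delta>]"
  have "\<not> sat_fm K (Box A) (f \<pi>)"
    using refutes_label[OF assms(2)] Box by blast
  \<comment> \<open>The counterexample \<open>u\<close> to the boxed formula becomes the world of
    the bracket that the rule creates.\<close>
  then obtain u where u: "(f \<pi>, u) \<in> acc K" "\<not> sat_fm K A u" by auto
  have same: "(f(?\<sigma> := u)) \<rho> = f \<rho>" if "\<rho> \<in> occs \<Gamma>" for \<rho>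
    using that fresh_occ[OF Box(3), of "[]"] by auto
  have new: "(f(?\<sigma> := u)) ?\<sigma> = u" "(f(?\<sigma> := u)) \<pi> = f \<pi>" by simp_all
  have old: "\<not> sat_fm K B ((f(?\<sigma> := u)) \<rho>)" if "(\<rho>, B) \<in> labels \<Gamma>" for \<rho> B
    unfolding same[OF labels_occs[OF that]] using assms(2) that by (auto simp: refutes_def)
  have old_acc: "((f(?\<sigma> := u)) \<rho>, (f(?\<sigma> := u)) (\<rho> @ [i])) \<in> acc K"
    if "\<rho> @ [i] \<in> occs \<Gamma>" for \<rho> i
    unfolding same[OF that] same[OF occs_prefix[OF that]]
    using assms(2) that by (simp add: refutes_def)
  have "refutes K (f(?\<sigma> := u)) (replace \<Gamma> \<pi> (\<Delta> @ [Bracket [Lf A]]))"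
    unfolding refutes_def occs_add_bracket[OF Box(3)] labels_add_bracket[OF Box(3)]
    using u new old old_acc by (auto simp del: fun_upd_apply)
  with same Box show ?thesis
    by (auto simp: occs_add_bracket simp del: fun_upd_apply)
qed

lemma refutes_prefix:
  assumes "refutes K f \<Gamma>" "\<sigma> @ \<rho> \<in> occs \<Gamma>" "trans (acc K)"
  shows "f \<sigma> = f (\<sigma> @ \<rho>) \<or> (f \<sigma>, f (\<sigma> @ \<rho>)) \<in> acc K"
  using assms(2)
proof (induction \<rho> rule: rev_induct)
  case Nil
  then show ?case by simp
next
  case (snoc i \<rho>)
  then have "(f (\<sigma> @ \<rho>), f (\<sigma> @ \<rho> @ [i])) \<in> acc K"
    using assms(1) by (metis append.assoc refutes_def)
  moreover have "\<sigma> @ \<rho> \<in> occs \<Gamma>"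
    using snoc.prems occs_prefix[of "\<sigma> @ \<rho>" "[i]"] by simp
  ultimately show ?case
    using snoc.IH assms(3) by (metis transD)
qed

lemma is_proof_infers:
  assumes "is_proof t" "subtree (Step \<Gamma> r T) t"
  shows "infers r \<Gamma> (concl ` rcset T)"
  using assms unfolding is_proof_def partial_proof_tree_def
  by (metis (no_types, lifting) bij_betw_imp_surj_on)

lemma is_proof_step:
  assumes "is_proof t" "subtree u t" "refutes K f (concl u)" "trans (acc K)"
  shows "\<exists>u'\<in>children u. \<exists>f'. refutes K f' (concl u') \<and> occs (concl u) \<subseteq> occs (concl u') \<and>
    (\<forall>\<pi>\<in>occs (concl u). f' \<pi> = f \<pi>)"
proof (cases u)
  case (Leaf \<Gamma>)
  with assms axiom_not_refuted[of \<Gamma> K f] show ?thesis by (auto simp: is_proof_def)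
next
  case (Step \<Gamma> r T)
  with assms have "infers r \<Gamma> (concl ` rcset T)"
    by (auto intro: is_proof_infers)
  from infers_refutes[OF this, of K f] assms(3,4) Step show ?thesis by auto
qed

lemma box_child:
  assumes "is_proof t" "subtree u t" "u = Step \<Gamma> (BoxR \<pi> A) T" "u' \<in> children u"
    and "content \<Gamma> \<pi> = Some \<Delta>"
  shows "\<pi> @ [length \<Delta>] \<in> occs (concl u')"
proof -
  have "infers (BoxR \<pi> A) \<Gamma> (concl ` rcset T)"
    using assms(1-3) by (auto intro: is_proof_infers)
  moreover have "concl u' \<in> concl ` rcset T"
    using assms(3,4) by simp
  ultimately show ?thesis
    using assms(5) by cases (auto simp: occs_add_bracket)
qed

lemma proof_not_refuted:
  fixes K :: "('w, 'p) kripke"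
  assumes "is_proof t" "trans (acc K)" "wf ((acc K)\<inverse>)"
  shows "\<not> refutes K f\<^sub>0 (concl t)"
proof
  assume r0: "refutes K f\<^sub>0 (concl t)"
  define inv where "inv = (\<lambda>s. subtree (fst s) t \<and> refutes K (snd s) (concl (fst s)))"
  define R where "R = (\<lambda>s s' :: 'p ptree \<times> (occ \<Rightarrow> 'w). fst s' \<in> children (fst s) \<and>
     occs (concl (fst s)) \<subseteq> occs (concl (fst s')) \<and>
     (\<forall>\<pi>\<in>occs (concl (fst s)). snd s' \<pi> = snd s \<pi>))"
  have ex: "\<exists>s'. inv s' \<and> R s s'" if "inv s" for s
  proof -
    have "subtree (fst s) t" "refutes K (snd s) (concl (fst s))"
      using that by (simp_all add: inv_def)
    from is_proof_step[OF assms(1) this assms(2)] obtain u f' where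
      u: "u \<in> children (fst s)" "refutes K f' (concl u)" "occs (concl (fst s)) \<subseteq> occs (concl u)"
        "\<forall>\<pi>\<in>occs (concl (fst s)). f' \<pi> = snd s \<pi>"
      by blast
    moreover have "subtree u t"
      using \<open>subtree (fst s) t\<close> u(1) unfolding subtree_def by (rule rtranclp.rtrancl_into_rtrancl)
    ultimately have "inv (u, f') \<and> R s (u, f')" by (simp add: inv_def R_def)
    then show ?thesis by blast
  qed
  have start: "inv (t, f\<^sub>0)" using r0 by (simp add: inv_def subtree_def)
  have "\<exists>s. \<forall>n. (inv (s n) \<and> (n = 0 \<longrightarrow> s n = (t, f\<^sub>0))) \<and> R (s n) (s (Suc n))"
    using start ex by (intro dependent_nat_choice) auto
  then obtain s where s: "s 0 = (t, f\<^sub>0)" "\<And>n. inv (s n)" "\<And>n. R (s n) (s (Suc n))"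
    by blast
  define b where "b = (\<lambda>n. fst (s n))"
  define f where "f = (\<lambda>n. snd (s n))"
  have sub: "subtree (b n) t" and ref: "refutes K (f n) (concl (b n))" for n
    using s(2)[of n] by (auto simp: inv_def b_def f_def)
  have child: "b (Suc n) \<in> children (b n)" for n
    using s(3)[of n] by (simp add: R_def b_def)
  have mono: "occs (concl (b m)) \<subseteq> occs (concl (b n)) \<and> (\<forall>\<pi>\<in>occs (concl (b m)). f n \<pi> = f m \<pi>)"
    if "m \<le> n" for m n
    using that
  proof (induction n rule: dec_induct)
    case base
    then show ?case by simp
  next
    case (step n)
    then show ?case using s(3)[of n] by (auto simp: R_def b_def f_def)
  qed
  have "infinite_branch t b" using s(1) child by (simp add: infinite_branch_def b_def)
  then obtain g :: "nat \<Rightarrow> nat" where g: "strict_mono g" "\<And>k. nested_in (b (g (Suc k))) (b (g k))"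
    using assms(1) unfolding is_proof_def by blast
  have "\<forall>k. \<exists>\<Gamma> \<pi> A T \<Delta>. b (g k) = Step \<Gamma> (BoxR \<pi> A) T \<and> content \<Gamma> \<pi> = Some \<Delta>"
    using g(2) unfolding nested_in_def by blast
  then obtain G p A T D where
    D: "\<And>k. b (g k) = Step (G k) (BoxR (p k) (A k)) (T k)" "\<And>k. content (G k) (p k) = Some (D k)"
    by metis
  define \<sigma> where "\<sigma> = (\<lambda>k. p k @ [length (D k)])"
  define a where "a = (\<lambda>k. f (Suc (g k)) (\<sigma> k))"
  have \<sigma>: "\<sigma> k \<in> occs (concl (b (Suc (g k))))" for k
    unfolding \<sigma>_def using box_child[OF assms(1) sub D(1) child D(2)] .
  have "(a k, a (Suc k)) \<in> acc K" for k
  proof -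
    have pre: "prefix (\<sigma> k) (p (Suc k))"
      using g(2)[of k] D(1)[of k] D(1)[of "Suc k"] D(2)[of k] by (auto simp: nested_in_def \<sigma>_def)
    then obtain \<rho> where \<rho>: "\<sigma> (Suc k) = \<sigma> k @ (\<rho> @ [length (D (Suc k))])"
      by (auto simp: prefix_def \<sigma>_def)
    let ?n = "Suc (g (Suc k))"
    have "Suc (g k) \<le> ?n"
      using g(1) by (simp add: strict_mono_Suc_iff less_imp_le)
    then have ak: "f ?n (\<sigma> k) = a k"
      using mono[of "Suc (g k)" ?n] \<sigma>[of k] by (simp add: a_def)
    have occ: "(\<sigma> k @ \<rho>) @ [length (D (Suc k))] \<in> occs (concl (b ?n))"
      using \<sigma>[of "Suc k"] \<rho> by simp
    have last: "(f ?n (\<sigma> k @ \<rho>), a (Suc k)) \<in> acc K"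
      using ref[of ?n] occ unfolding refutes_def a_def \<rho> append.assoc[symmetric] by blast
    from refutes_prefix[OF ref occs_prefix[OF occ] assms(2)] ak last
    show ?thesis using assms(2) by (auto dest: transD)
  qed
  with assms(3) show False by (auto simp: wf_iff_no_infinite_down_chain)
qed

theorem theorem3p9:
  fixes \<Gamma> :: "'p sequent" and K :: "('w, 'p) kripke" and w :: 'w
  assumes "nested_sequent \<Gamma>"
    and "derivable \<Gamma>"
    and "kripke_model K"
    and "transitive_model K"
    and "conversely_wf_model K"
    and "supports K \<Gamma>"
    and "w \<in> worlds K"
  shows "sat K w \<Gamma>"
proof (rule ccontr)
  assume neg: "\<not> sat K w \<Gamma>"
  obtain t where t: "is_proof t" "sequent_of (concl t) = \<Gamma>"
    using assms(2) by (auto simp: derivable_def)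
  obtain f where "refutes K f (concl t)"
    using refutes_exists[OF neg[folded t(2)]] by blast
  moreover have "trans (acc K)" "wf ((acc K)\<inverse>)"
    using assms(4,5) by (simp_all add: transitive_model_def conversely_wf_model_def)
  ultimately show False
    using proof_not_refuted[OF t(1)] by blast
qed

end
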